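(* Let $L<H$ be reals, let $\Theta=\{L,H\}^n$ be the two-values domain, and let $\lambda\in[0,1]$. The $\lambda$-linear mechanism with algorithm $A$ is bribeproof for the two-values domain $\Theta$ if and only if algorithm $A$ satisfies the following conditions: for all $\theta\in\Theta$ and for all $i\in N$, $I_i(A_i,\theta)\ge 0$ (monotonicity) and, for all $\ell\in N$ with $\theta_\ell=L$ and for all $h\in N$ with $\theta_h=H$, $$(1-\lambda)\, I_i(A_i,\theta)\ \ge\ (\lambda-1)\, I_i(A_\ell,\theta),$$ $$(1-\lambda)\, I_i(A_i,\theta)\ \ge\ \lambda\, I_i(A_h,\theta),$$ $$\lambda\, I_i(A_i,\theta)\ \ge\ (1-\lambda)\, I_i(A_\ell,\theta),$$ $$\lambda\, I_i(A_i,\theta)\ \ge\ -\lambda\, I_i(A_h,\theta).$$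
   Context: There is a set $N=\{1,\dots,n\}$ of $n\ge 2$ agents and a set $\mathcal{A}\subseteq\mathbb{R}_+^n$ of feasible allocations; $a_i$ is the amount of work allocated to agent $i$, whose cost for $a\in\mathcal{A}$ is $a_i\theta_i$, where $\theta_i\in\Theta_i\subseteq\mathbb{R}$ is her private type. $\Theta=\Theta_1\times\cdots\times\Theta_n$; in a two-values domain $\Theta_i=\{L,H\}$ for all $i$. A mechanism is a pair $(A,p)$ with $A:\Theta\to\mathcal{A}$ (the algorithm) and $p:\Theta\to\mathbb{R}^n$ (payments made to the agents). Notation: $(x,\theta_{-i})$ is $\theta$ with its $i$-th entry replaced by $x$. $(A,p)$ is bribeproof if for all $\theta\in\Theta$, all $i$ and $j$ in $N$, and all $\hat\theta_i\in\Theta_i$, writing $\hat\theta=(\hat\theta_i,\theta_{-i})$, $$p_i(\theta)-A_i(\theta)\theta_i+p_j(\theta)-A_j(\theta)\theta_j\ge p_i(\hat\theta)-A_i(\hat\theta)\theta_i+p_j(\hat\theta)-A_j(\hat\theta)\theta_j;$$ the case $i=j$ is included and amounts to strategyproofness, $p_i(\theta)-A_i(\theta)\theta_i\ge p_i(\hat\theta)-A_i(\hat\theta)\theta_i$. For $\lambda\in[0,1]$, a $\lambda$-linear mechanism with algorithm $A$ is a mechanism $(A,p)$ with $p_i(\theta)=A_i(\theta)\,(\lambda L+(1-\lambda)H)+f_i$ for all $i$ and $\theta$, where the $f_i$ are constants. For agents $i,k$ and $\theta\in\Theta$, the $i$-influence on $k$ is $I_i(A_k,\theta):=A_k(L,\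theta_{-i})-A_k(H,\theta_{-i})$.
   Formalization: The agents ℓ and h are required to differ from i (with ℓ = i or h = i allowed, the "only if" direction fails, e.g. λ = 0, A_1 = 1 exactly when θ_1 = L, other A_k = 0), and each inequality is quantified only over the one of ℓ, h that it mentions. *)

theory Defs
  imports "HOL-Analysis.Finite_Cartesian_Product"
begin

text \<open>
  Agents are the elements of a finite index type \<open>'n\<close>; type profiles, allocations and
  payment profiles are vectors in \<open>real ^ 'n\<close>.  Algorithms and payment rules are total
  functions, but only their values on the type domain matter.
\<close>

definition type_domain :: "('n::finite \<Rightarrow> real set) \<Rightarrow> (real ^ 'n) set" where
  "type_domain T = {\<theta>. \<forall>i. \<theta> $ i \<in> T i}"

definition two_values_domain :: "real \<Rightarrow> real \<Rightarrow> (real ^ 'n::finite) set" where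
  "two_values_domain L H = type_domain (\<lambda>_. {L, H})"

definition replace_entry :: "'n::finite \<Rightarrow> real \<Rightarrow> real ^ 'n \<Rightarrow> real ^ 'n" where
  "replace_entry i x \<theta> = (\<chi> j. if j = i then x else \<theta> $ j)"

definition mechanism ::
  "('n::finite \<Rightarrow> real set) \<Rightarrow> (real ^ 'n) set \<Rightarrow>
    (real ^ 'n \<Rightarrow> real ^ 'n) \<Rightarrow> (real ^ 'n \<Rightarrow> real ^ 'n) \<Rightarrow> bool" where
  "mechanism T \<A> A p \<longleftrightarrow>
     \<A> \<subseteq> {a. \<forall>i. 0 \<le> a $ i} \<and> (\<forall>\<theta> \<in> type_domain T. A \<theta> \<in> \<A>)"

text \<open>
  The first argument of \<open>utility\<close> is the profile of true types, the last one the profile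
  of reported types.
\<close>

definition utility ::
  "real ^ 'n \<Rightarrow> (real ^ 'n \<Rightarrow> real ^ 'n) \<Rightarrow> (real ^ 'n \<Rightarrow> real ^ 'n) \<Rightarrow>
    'n::finite \<Rightarrow> real ^ 'n \<Rightarrow> real" where
  "utility \<theta> A p i \<theta>' = p \<theta>' $ i - A \<theta>' $ i * \<theta> $ i"

definition bribeproof ::
  "('n::finite \<Rightarrow> real set) \<Rightarrow> (real ^ 'n \<Rightarrow> real ^ 'n) \<Rightarrow> (real ^ 'n \<Rightarrow> real ^ 'n) \<Rightarrow> bool" where
  "bribeproof T A p \<longleftrightarrow>
     (\<forall>\<theta> \<in> type_domain T. \<forall>i j. \<forall>t \<in> T i.
        utility \<theta> A p i \<theta> + utility \<theta> A p j \<theta> \<ge>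
        utility \<theta> A p i (replace_entry i t \<theta>) + utility \<theta> A p j (replace_entry i t \<theta>))"

definition linear_mechanism ::
  "real \<Rightarrow> real \<Rightarrow> real \<Rightarrow> (real ^ 'n::finite) set \<Rightarrow>
    (real ^ 'n \<Rightarrow> real ^ 'n) \<Rightarrow> (real ^ 'n \<Rightarrow> real ^ 'n) \<Rightarrow> bool" where
  "linear_mechanism lam L H \<A> A p \<longleftrightarrow>
     mechanism (\<lambda>_. {L, H}) \<A> A p \<and>
     (\<exists>f :: real ^ 'n. \<forall>\<theta> \<in> two_values_domain L H. \<forall>i.
        p \<theta> $ i = A \<theta> $ i * (lam * L + (1 - lam) * H) + f $ i)"

text \<open>\<open>influence L H i g \<theta>\<close> is the \<open>i\<close>-influence on the agent with allocation function \<open>g\<close>.\<close>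

definition influence ::
  "real \<Rightarrow> real \<Rightarrow> 'n::finite \<Rightarrow> (real ^ 'n \<Rightarrow> real) \<Rightarrow> real ^ 'n \<Rightarrow> real" where
  "influence L H i g \<theta> = g (replace_entry i L \<theta>) - g (replace_entry i H \<theta>)"

end

theory Submission
  imports Defs
begin

text \<open>
  Write \<open>m = lam * L + (1 - lam) * H\<close>. Up to a constant, agent \<open>k\<close> with type \<open>\<theta> $ k\<close> has utility
  \<open>A \<theta>' $ k * (m - \<theta> $ k)\<close>, where \<open>m - L = (1 - lam) * (H - L)\<close> and \<open>m - H = - lam * (H - L)\<close>.
  A deviation of agent \<open>i\<close> thus changes the joint utility of \<open>i\<close> and \<open>j\<close> by a combination of
  the \<open>i\<close>-influences on \<open>i\<close> and \<open>j\<close>, whose coefficients depend only on their types. Since influences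
  do not depend on the type of \<open>i\<close>, both possible types of \<open>i\<close> give a condition at every profile.
\<close>

lemma replace_entry_nth [simp]:
  "replace_entry i x \<theta> $ j = (if j = i then x else \<theta> $ j)"
  by (simp add: replace_entry_def)

lemma replace_entry_replace_entry [simp]:
  "replace_entry i x (replace_entry i y \<theta>) = replace_entry i x \<theta>"
  by (simp add: vec_eq_iff)

lemma replace_entry_same: "\<theta> $ i = x \<Longrightarrow> replace_entry i x \<theta> = \<theta>"
  by (auto simp: vec_eq_iff)

lemma influence_replace_entry [simp]:
  "influence L H i g (replace_entry i x \<theta>) = influence L H i g \<theta>"
  by (simp add: influence_def)

lemma two_values_domainD: "\<theta> \<in> two_values_domain L H \<Longrightarrow> \<theta> $ i = L \<or> \<theta> $ i = H"
  by (auto simp: two_values_domain_def type_domain_def)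

lemma replace_entry_in_two_values_domain:
  "\<theta> \<in> two_values_domain L H \<Longrightarrow> x \<in> {L, H} \<Longrightarrow> replace_entry i x \<theta> \<in> two_values_domain L H"
  by (auto simp: two_values_domain_def type_domain_def)

text \<open>With \<open>m\<close> the payment per unit of work, \<open>m - \<theta> $ k\<close> is
  the profit of \<open>k\<close> per unit. The value is what \<open>i\<close> and \<open>j\<close>
  jointly gain when \<open>i\<close> reports \<open>L\<close> rather than \<open>H\<close> at true
  types \<open>\<theta>\<close>; for \<open>i = j\<close> it is doubled, as in
  \<open>bribeproof\<close>.\<close>

definition pair_surplus ::
  "real \<Rightarrow> real \<Rightarrow> real \<Rightarrow> (real ^ 'n \<Rightarrow> real ^ 'n) \<Rightarrow> 'n::finite \<Rightarrow> 'n \<Rightarrow> real ^ 'n \<Rightarrow> real" where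
  "pair_surplus m L H A i j \<theta> =
     (m - \<theta> $ i) * influence L H i (\<lambda>t. A t $ i) \<theta> +
     (m - \<theta> $ j) * influence L H i (\<lambda>t. A t $ j) \<theta>"

text \<open>The constants \<open>f\<close> cancel between two reports, and with two values the only
  real deviation is the flip. Truthfulness favors report \<open>L\<close> at true type
  \<open>L\<close> and report \<open>H\<close> at true type \<open>H\<close>, hence the opposite
  signs.\<close>

lemma bribeproof_iff_pair_surplus:
  fixes A p :: "real ^ 'n::finite \<Rightarrow> real ^ 'n"
  assumes p: "\<And>\<theta> i. \<theta> \<in> two_values_domain L H \<Longrightarrow> p \<theta> $ i = A \<theta> $ i * m + f i"
  shows "bribeproof (\<lambda>_. {L, H}) A p \<longleftrightarrow>
    (\<forall>\<theta> \<in> two_values_domain L H. \<forall>i j.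
       pair_surplus m L H A i j (replace_entry i L \<theta>) \<ge> 0 \<and>
       pair_surplus m L H A i j (replace_entry i H \<theta>) \<le> 0)"
    (is "?lhs \<longleftrightarrow> ?rhs")
proof -
  define ok where "ok \<theta> i j t \<longleftrightarrow>
    utility \<theta> A p i \<theta> + utility \<theta> A p j \<theta> \<ge>
    utility \<theta> A p i (replace_entry i t \<theta>) + utility \<theta> A p j (replace_entry i t \<theta>)" for \<theta> i j t
  have bp: "?lhs \<longleftrightarrow> (\<forall>\<theta> \<in> two_values_domain L H. \<forall>i j. ok \<theta> i j L \<and> ok \<theta> i j H)"
    by (auto simp: bribeproof_def ok_def two_values_domain_def)
  have ok_same: "ok \<theta> i j (\<theta> $ i)" for \<theta> i j
    by (simp add: ok_def replace_entry_same)
  have ok_L: "ok (replace_entry i L \<theta>) i j H \<longleftrightarrow> pair_surplus m L H A i j (replace_entry i L \<theta>) \<ge> 0"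
    and ok_H: "ok (replace_entry i H \<theta>) i j L \<longleftrightarrow> pair_surplus m L H A i j (replace_entry i H \<theta>) \<le> 0"
    if "\<theta> \<in> two_values_domain L H" for \<theta> i j
    \<comment> \<open>The payment formula holds on the domain only, so both reported profiles have
      to lie there.\<close>
    using replace_entry_in_two_values_domain[OF that, of L i]
      replace_entry_in_two_values_domain[OF that, of H i]
    by (auto simp: ok_def pair_surplus_def utility_def influence_def p algebra_simps)
  show ?thesis
  proof
    assume ?lhs
    then show ?rhs
      unfolding bp using ok_L ok_H replace_entry_in_two_values_domain by blast
  next
    assume ?rhs
    \<comment> \<open>\<open>\<theta>\<close> equals one of its two replacements at
      \<open>i\<close>: one of the two reports is truthful, the other is the flip treated by
      \<open>ok_L\<close> or \<open>ok_H\<close>.\<close>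
    have "ok \<theta> i j L \<and> ok \<theta> i j H" if "\<theta> \<in> two_values_domain L H" for \<theta> i j
      using two_values_domainD[OF that, of i] ok_same[of \<theta> i j] ok_L[OF that, of i j]
        ok_H[OF that, of i j] \<open>?rhs\<close> that by (auto simp: replace_entry_same)
    then show ?lhs
      unfolding bp by blast
  qed
qed

theorem theorem4:
  fixes L H lam :: real
    and \<A> :: "(real ^ 'n::finite) set"
    and A p :: "real ^ 'n \<Rightarrow> real ^ 'n"
  assumes "2 \<le> CARD('n)"
    and "L < H"
    and "0 \<le> lam" and "lam \<le> 1"
    and "linear_mechanism lam L H \<A> A p"
  shows "bribeproof (\<lambda>_. {L, H}) A p \<longleftrightarrow>
    (\<forall>\<theta> \<in> two_values_domain L H. \<forall>i.
       influence L H i (\<lambda>t. A t $ i) \<theta> \<ge> 0 \<and>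
       (\<forall>l. l \<noteq> i \<and> \<theta> $ l = L \<longrightarrow>
          (1 - lam) * influence L H i (\<lambda>t. A t $ i) \<theta> \<ge>
            (lam - 1) * influence L H i (\<lambda>t. A t $ l) \<theta>) \<and>
       (\<forall>h. h \<noteq> i \<and> \<theta> $ h = H \<longrightarrow>
          (1 - lam) * influence L H i (\<lambda>t. A t $ i) \<theta> \<ge>
            lam * influence L H i (\<lambda>t. A t $ h) \<theta>) \<and>
       (\<forall>l. l \<noteq> i \<and> \<theta> $ l = L \<longrightarrow>
          lam * influence L H i (\<lambda>t. A t $ i) \<theta> \<ge>
            (1 - lam) * influence L H i (\<lambda>t. A t $ l) \<theta>) \<and>
       (\<forall>h. h \<noteq> i \<and> \<theta> $ h = H \<longrightarrow>
          lam * influence L H i (\<lambda>t. A t $ i) \<theta> \<ge>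
            - lam * influence L H i (\<lambda>t. A t $ h) \<theta>))"
proof -
  define m where "m = lam * L + (1 - lam) * H"
  define d where "d = H - L"
  have d: "d > 0" and mL: "m - L = (1 - lam) * d" and mH: "m - H = - lam * d"
    using assms(2) by (simp_all add: d_def m_def algebra_simps)
  obtain f :: "real ^ 'n"
    where f: "\<And>\<theta> i. \<theta> \<in> two_values_domain L H \<Longrightarrow> p \<theta> $ i = A \<theta> $ i * m + f $ i"
    using assms(5) unfolding linear_mechanism_def m_def by blast
  let ?I = "\<lambda>i k. influence L H i (\<lambda>t. A t $ k)"
  let ?S = "\<lambda>\<theta> i j. pair_surplus m L H A i j (replace_entry i L \<theta>) \<ge> 0 \<and>
    pair_surplus m L H A i j (replace_entry i H \<theta>) \<le> 0"
  have self: "?S \<theta> i i \<longleftrightarrow> ?I i i \<theta> \<ge> 0" for \<theta> i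
  proof -
    have "?S \<theta> i i \<longleftrightarrow> 0 \<le> (1 - lam) * ?I i i \<theta> \<and> 0 \<le> lam * ?I i i \<theta>"
      using d by (simp add: pair_surplus_def mL mH zero_le_mult_iff mult_le_0_iff)
    also have "\<dots> \<longleftrightarrow> ?I i i \<theta> \<ge> 0"
    proof
      assume "0 \<le> (1 - lam) * ?I i i \<theta> \<and> 0 \<le> lam * ?I i i \<theta>"
      \<comment> \<open>The weights sum to 1, so adding the inequalities also covers
        \<open>lam = 0\<close> and \<open>lam = 1\<close>, where one of them is void.\<close>
      then have "0 \<le> (1 - lam) * ?I i i \<theta> + lam * ?I i i \<theta>"
        by linarith
      then show "0 \<le> ?I i i \<theta>"
        by (simp add: algebra_simps)
    qed (use assms(3,4) in simp)
    finally show ?thesis .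
  qed
  \<comment> \<open>As \<open>l \<noteq> i\<close>, the type of \<open>l\<close> stays
    \<open>L\<close> under both replacements; the first inequality comes from \<open>i\<close> of
    type \<open>L\<close>, the second from \<open>i\<close> of type \<open>H\<close>. The factor
    \<open>d > 0\<close> divides out.\<close>
  have low: "?S \<theta> i l \<longleftrightarrow>
      (1 - lam) * ?I i i \<theta> \<ge> (lam - 1) * ?I i l \<theta> \<and> lam * ?I i i \<theta> \<ge> (1 - lam) * ?I i l \<theta>"
    if "l \<noteq> i" "\<theta> $ l = L" for \<theta> i l
  proof -
    have "pair_surplus m L H A i l (replace_entry i L \<theta>) =
        d * ((1 - lam) * ?I i i \<theta> - (lam - 1) * ?I i l \<theta>)"
      "pair_surplus m L H A i l (replace_entry i H \<theta>) =
        d * ((1 - lam) * ?I i l \<theta> - lam * ?I i i \<theta>)"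
      using that by (simp_all add: pair_surplus_def mL mH) (simp_all add: algebra_simps)
    then show ?thesis
      using d by (simp add: zero_le_mult_iff mult_le_0_iff)
  qed
  have high: "?S \<theta> i h \<longleftrightarrow>
      (1 - lam) * ?I i i \<theta> \<ge> lam * ?I i h \<theta> \<and> lam * ?I i i \<theta> \<ge> - lam * ?I i h \<theta>"
    if "h \<noteq> i" "\<theta> $ h = H" for \<theta> i h
  proof -
    have "pair_surplus m L H A i h (replace_entry i L \<theta>) =
        d * ((1 - lam) * ?I i i \<theta> - lam * ?I i h \<theta>)"
      "pair_surplus m L H A i h (replace_entry i H \<theta>) =
        d * (- lam * ?I i h \<theta> - lam * ?I i i \<theta>)"
      using that by (simp_all add: pair_surplus_def mL mH) (simp_all add: algebra_simps)
    then show ?thesis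
      using d by (simp add: zero_le_mult_iff mult_le_0_iff)
  qed
  have split: "(\<forall>j. ?S \<theta> i j) \<longleftrightarrow> ?S \<theta> i i \<and>
      (\<forall>l. l \<noteq> i \<and> \<theta> $ l = L \<longrightarrow> ?S \<theta> i l) \<and> (\<forall>h. h \<noteq> i \<and> \<theta> $ h = H \<longrightarrow> ?S \<theta> i h)"
    if "\<theta> \<in> two_values_domain L H" for \<theta> i
    using two_values_domainD[OF that] by metis
  have "bribeproof (\<lambda>_. {L, H}) A p \<longleftrightarrow> (\<forall>\<theta> \<in> two_values_domain L H. \<forall>i. \<forall>j. ?S \<theta> i j)"
    using f by (rule bribeproof_iff_pair_surplus)
  also have "\<dots> \<longleftrightarrow> (\<forall>\<theta> \<in> two_values_domain L H. \<forall>i.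
      ?I i i \<theta> \<ge> 0 \<and>
      (\<forall>l. l \<noteq> i \<and> \<theta> $ l = L \<longrightarrow>
        (1 - lam) * ?I i i \<theta> \<ge> (lam - 1) * ?I i l \<theta> \<and> lam * ?I i i \<theta> \<ge> (1 - lam) * ?I i l \<theta>) \<and>
      (\<forall>h. h \<noteq> i \<and> \<theta> $ h = H \<longrightarrow>
        (1 - lam) * ?I i i \<theta> \<ge> lam * ?I i h \<theta> \<and> lam * ?I i i \<theta> \<ge> - lam * ?I i h \<theta>))"
    \<comment> \<open>\<open>ball_cong\<close> supplies the domain membership for
      \<open>split\<close>; \<open>imp_cong\<close> makes the type of the partner available to
      \<open>low\<close> and \<open>high\<close>.\<close>
    by (intro ball_cong refl iff_allI) (simp only: split self low high not_False_eq_True cong: imp_cong)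
  finally show ?thesis
    by blast
qed

end
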